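(* There exists a sequence of Boolean functions $f_k:\{0,1\}^{N_k}\to\{0,1\}$ with $D^{sc}(f_k)\to\infty$ such that $D(f_k)=\Omega\big((D^{sc}(f_k))^{2-o(1)}\big)$, i.e. $D(f_k)\ge (D^{sc}(f_k))^{2-\epsilon_k}$ for all sufficiently large $k$, for some sequence $\epsilon_k\to 0$.
   Context: For $f:\{0,1\}^n\to\{0,1\}$, $D(f)$ (deterministic query complexity) is the minimum, over deterministic decision trees computing $f$, of the maximum number of input variables queried on any input. A partial assignment fixes the values of a subset of the variables; its length is the number of fixed variables, and the subcube it defines is the set of inputs consistent with it. $D^{sc}(f)$ (subcube partition complexity) is the smallest $k$ such that $\{0,1\}^n$ can be partitioned into disjoint subcubes, each defined by a partial assignment of length at most $k$, with $f$ constant on every subcube. *)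

theory Defs
  imports "HOL-Analysis.Analysis"
begin

text \<open>
  Inputs are indexed by an arbitrary (finite) set \<open>I\<close> of variables; \<open>{0,1}\<^sup>n\<close> is the case
  \<open>I = {..<n}\<close>. A Boolean function on \<open>{0,1}\<^sup>I\<close> is a predicate \<open>f\<close> on assignments, of which only
  the values on \<open>cube I\<close> matter.
\<close>

definition cube :: "'i set \<Rightarrow> ('i \<Rightarrow> bool) set" where
  "cube I = I \<rightarrow>\<^sub>E UNIV"

text \<open>\<open>Query i l r\<close> queries variable \<open>i\<close> and continues with \<open>l\<close> on answer 0, with \<open>r\<close> on answer 1.\<close>

datatype (tree_vars: 'i) dec_tree = Leaf bool | Query 'i "'i dec_tree" "'i dec_tree"

primrec tree_output :: "'i dec_tree \<Rightarrow> ('i \<Rightarrow> bool) \<Rightarrow> bool" where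
  "tree_output (Leaf b) x = b"
| "tree_output (Query i l r) x = (if x i then tree_output r x else tree_output l x)"

primrec tree_queried :: "'i dec_tree \<Rightarrow> ('i \<Rightarrow> bool) \<Rightarrow> 'i set" where
  "tree_queried (Leaf b) x = {}"
| "tree_queried (Query i l r) x = insert i (if x i then tree_queried r x else tree_queried l x)"

definition tree_computes :: "'i set \<Rightarrow> 'i dec_tree \<Rightarrow> (('i \<Rightarrow> bool) \<Rightarrow> bool) \<Rightarrow> bool" where
  "tree_computes I T f \<longleftrightarrow> tree_vars T \<subseteq> I \<and> (\<forall>x\<in>cube I. tree_output T x = f x)"

definition tree_cost :: "'i set \<Rightarrow> 'i dec_tree \<Rightarrow> nat" where
  "tree_cost I T = Max ((\<lambda>x. card (tree_queried T x)) ` cube I)"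

text \<open>For finite \<open>I\<close> some tree computes \<open>f\<close>, so the infimum (in \<open>nat\<close>) is a minimum.\<close>

definition det_query_complexity :: "'i set \<Rightarrow> (('i \<Rightarrow> bool) \<Rightarrow> bool) \<Rightarrow> nat" where
  "det_query_complexity I f = (INF T\<in>{T. tree_computes I T f}. tree_cost I T)"

text \<open>A partial assignment is a map \<open>\<rho>\<close> with \<open>dom \<rho> \<subseteq> I\<close>; its length is \<open>card (dom \<rho>)\<close>.\<close>

definition subcube :: "'i set \<Rightarrow> ('i \<rightharpoonup> bool) \<Rightarrow> ('i \<Rightarrow> bool) set" where
  "subcube I \<rho> = {x \<in> cube I. \<forall>i\<in>dom \<rho>. \<rho> i = Some (x i)}"

definition subcube_partition ::
    "'i set \<Rightarrow> (('i \<Rightarrow> bool) \<Rightarrow> bool) \<Rightarrow> nat \<Rightarrow> ('i \<Rightarrow> bool) set set \<Rightarrow> bool" where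
  "subcube_partition I f k P \<longleftrightarrow>
     partition_on (cube I) P \<and>
     (\<forall>C\<in>P. (\<exists>\<rho>. dom \<rho> \<subseteq> I \<and> card (dom \<rho>) \<le> k \<and> C = subcube I \<rho>) \<and> f constant_on C)"

definition subcube_partition_complexity :: "'i set \<Rightarrow> (('i \<Rightarrow> bool) \<Rightarrow> bool) \<Rightarrow> nat" where
  "subcube_partition_complexity I f = (LEAST k. \<exists>P. subcube_partition I f k P)"

end

theory Submission
  imports Defs "HOL-Real_Asymp.Real_Asymp"
begin

text \<open>
  The functions are those of Ambainis, Kokainis and Kothari:
  \<open>f\<^sub>0 = AND\<^sub>n\<close> and \<open>f\<^sub>k\<^sub>+\<^sub>1 = AND\<^sub>n \<circ> CS (AND\<^sub>n \<circ> \<not> f\<^sub>k)\<close>, where \<open>CS\<close> is the cheat sheet construction.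
  Up to polylogarithmic factors, \<open>f\<^sub>k\<close> has deterministic complexity \<open>n ^ (2 k + 1)\<close>, certificate
  complexities \<open>C\<^sub>0 = n ^ k\<close>, \<open>C\<^sub>1 = n ^ (k + 1)\<close>, and unambiguous certificates of size \<open>n ^ (k + 1)\<close>.
  A conjunction multiplies the deterministic complexity and the size of 1-certificates by \<open>n\<close>,
  so \<open>g = AND\<^sub>n \<circ> \<not> f\<^sub>k\<close> has \<open>C\<^sub>0 = C\<^sub>1 = n ^ (k + 1)\<close> and unambiguous certificates of size
  \<open>n ^ (k + 2)\<close>. An input of \<open>CS g\<close> consists of logarithmically many inputs of \<open>g\<close>, whose values
  form the address of a cell; it is a 1-input if that cell describes certificates for these values.
  Reading this cell and the certificates is an unambiguous certificate of a 1-input, of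
  size only about \<open>n ^ (k + 1)\<close>, while the deterministic complexity does not drop, as there are too
  many cells to search. In the outer conjunction only the first 0-block has to pay \<open>n ^ (k + 2)\<close>;
  the blocks before it pay \<open>n ^ (k + 1)\<close> each.
\<close>

section \<open>Adversary strategies\<close>

definition fill :: "('i \<rightharpoonup> bool) \<Rightarrow> ('i \<Rightarrow> bool) \<Rightarrow> 'i \<Rightarrow> bool" where
  "fill \<rho> x i = (case \<rho> i of None \<Rightarrow> x i | Some b \<Rightarrow> b)"

lemma fill_empty [simp]: "fill Map.empty x = x"
  by (auto simp: fill_def)

lemma fill_upd_self: "fill (\<rho>(i \<mapsto> fill \<rho> x i)) x = fill \<rho> x"
  by (auto simp: fill_def fun_eq_iff split: option.split)

text \<open>\<open>hard f d \<rho>\<close> says that an adversary can keep \<open>f\<close>, restricted by \<open>\<rho>\<close>, undetermined during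
  the next \<open>d - 1\<close> queries.\<close>

primrec hard :: "(('i \<Rightarrow> bool) \<Rightarrow> bool) \<Rightarrow> nat \<Rightarrow> ('i \<rightharpoonup> bool) \<Rightarrow> bool" where
  "hard f 0 \<rho> \<longleftrightarrow> True"
| "hard f (Suc d) \<rho> \<longleftrightarrow> (\<exists>x y. f (fill \<rho> x) \<and> \<not> f (fill \<rho> y)) \<and>
     (\<forall>i. \<rho> i = None \<longrightarrow> (\<exists>b. hard f d (\<rho>(i \<mapsto> b))))"

lemma hard_SucD: "hard f (Suc d) \<rho> \<Longrightarrow> hard f d \<rho>"
proof (induction d arbitrary: \<rho>)
  case (Suc d)
  show ?case
    unfolding hard.simps(2)[of f d]
  proof (intro conjI allI impI)
    show "\<exists>x y. f (fill \<rho> x) \<and> \<not> f (fill \<rho> y)"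
      using Suc.prems by simp
  next
    fix i assume "\<rho> i = None"
    then obtain b where "hard f (Suc d) (\<rho>(i \<mapsto> b))"
      using Suc.prems unfolding hard.simps(2)[of f "Suc d"] by blast
    then show "\<exists>b. hard f d (\<rho>(i \<mapsto> b))"
      using Suc.IH by blast
  qed
qed simp

lemma hard_not: "hard f d \<rho> \<Longrightarrow> hard (\<lambda>x. \<not> f x) d \<rho>"
proof (induction d arbitrary: \<rho>)
  case (Suc d)
  then show ?case by (simp only: hard.simps) blast
qed simp

lemma hard_nonconst:
  assumes "hard f d \<rho>" "d > 0"
  obtains x y where "f (fill \<rho> x)" "\<not> f (fill \<rho> y)"
  using assms by (cases d) auto

text \<open>A query outside the range of \<open>h\<close> leaves the pulled-back restriction
  unchanged and so costs the adversary nothing; a query at \<open>h i\<close> is answered like the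
  query \<open>i\<close>.\<close>

lemma hard_reindex:
  assumes "inj h" "hard f d (\<lambda>i. \<rho> (h i))"
  shows "hard (\<lambda>x. f (\<lambda>i. x (h i))) d \<rho>"
  using assms(2)
proof (induction d arbitrary: \<rho>)
  case (Suc d)
  have fill_pull: "(\<lambda>i. fill \<rho> (x \<circ> inv h) (h i)) = fill (\<lambda>i. \<rho> (h i)) x" for x
    using assms(1) by (auto simp: fill_def fun_eq_iff split: option.split)
  obtain x y where "f (fill (\<lambda>i. \<rho> (h i)) x)" "\<not> f (fill (\<lambda>i. \<rho> (h i)) y)"
    using Suc.prems by auto
  then have "\<exists>x y. f (\<lambda>i. fill \<rho> x (h i)) \<and> \<not> f (\<lambda>i. fill \<rho> y (h i))"
    using fill_pull by metis
  moreover have "\<exists>b. hard (\<lambda>x. f (\<lambda>i. x (h i))) d (\<rho>(v \<mapsto> b))" if v: "\<rho> v = None" for v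
  proof (cases "v \<in> range h")
    case True
    then obtain i where i: "v = h i" by blast
    then obtain b where "hard f d ((\<lambda>i. \<rho> (h i))(i \<mapsto> b))"
      using Suc.prems v by auto
    moreover have "(\<lambda>i. \<rho> (h i))(i \<mapsto> b) = (\<lambda>i'. (\<rho>(v \<mapsto> b)) (h i'))"
      using assms(1) i by (auto simp: fun_eq_iff inj_eq)
    ultimately show ?thesis
      using Suc.IH[of "\<rho>(v \<mapsto> b)"] by (metis (no_types))
  next
    case False
    then have "(\<lambda>i'. (\<rho>(v \<mapsto> True)) (h i')) = (\<lambda>i. \<rho> (h i))"
      by (auto simp: fun_eq_iff)
    then show ?thesis
      using Suc.IH[of "\<rho>(v \<mapsto> True)"] hard_SucD[OF Suc.prems] by (metis (no_types))
  qed
  ultimately show ?case by simp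
qed simp

lemma finite_tree_queried [simp]: "finite (tree_queried T x)"
  by (induction T) auto

text \<open>The adversary's answers select a path in the tree. Only queries outside
  \<open>dom \<rho>\<close> are counted, since the others have a fixed answer; each of them costs
  one unit of \<open>d\<close>. A leaf has constant output and can be correct only when nothing is
  left of \<open>d\<close>.\<close>

lemma hard_tree_queried:
  assumes "\<And>x. tree_output T (fill \<rho> x) = f (fill \<rho> x)" "hard f d \<rho>"
  shows "\<exists>x. d \<le> card (tree_queried T (fill \<rho> x) - dom \<rho>)"
  using assms
proof (induction T arbitrary: \<rho> d)
  case (Leaf b)
  then have "d = 0" by (cases d) auto
  then show ?case by simp
next
  case (Query i l r)
  show ?case
  proof (cases "\<rho> i")
    case (Some b)
    then have b: "fill \<rho> x i = b" for x by (simp add: fill_def)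
    show ?thesis
    proof (cases b)
      case True
      then have "\<exists>x. d \<le> card (tree_queried r (fill \<rho> x) - dom \<rho>)"
        using Query.prems b by (intro Query.IH) auto
      moreover have "insert i X - dom \<rho> = X - dom \<rho>" for X using Some by auto
      ultimately show ?thesis using True b by simp
    next
      case False
      then have "\<exists>x. d \<le> card (tree_queried l (fill \<rho> x) - dom \<rho>)"
        using Query.prems b by (intro Query.IH) auto
      moreover have "insert i X - dom \<rho> = X - dom \<rho>" for X using Some by auto
      ultimately show ?thesis using False b by simp
    qed
  next
    case None
    show ?thesis
    proof (cases d)
      case (Suc d')
      then obtain b where b: "hard f d' (\<rho>(i \<mapsto> b))"
        using None Query.prems by auto
      let ?\<rho> = "\<rho>(i \<mapsto> b)" and ?T = "if b then r else l"
      have i: "fill ?\<rho> x i = b" for x by (simp add: fill_def)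
      have fill2: "fill \<rho> (fill ?\<rho> x) = fill ?\<rho> x" for x
        using None by (auto simp: fill_def fun_eq_iff split: option.split)
      have out: "tree_output ?T (fill ?\<rho> x) = f (fill ?\<rho> x)" for x
        using Query.prems(1)[of "fill ?\<rho> x"] i[of x] by (simp add: fill2 split: if_splits)
      have "\<exists>x. d' \<le> card (tree_queried ?T (fill ?\<rho> x) - dom ?\<rho>)"
        using Query.IH[of ?\<rho> d'] out b by (cases b) (simp_all only: if_True if_False)
      then obtain x where x: "d' \<le> card (tree_queried ?T (fill ?\<rho> x) - dom ?\<rho>)" by blast
      have "tree_queried (Query i l r) (fill ?\<rho> x) - dom \<rho>
          = insert i (tree_queried ?T (fill ?\<rho> x) - dom ?\<rho>)"
        using None i[of x] by auto
      then have "Suc d' \<le> card (tree_queried (Query i l r) (fill \<rho> (fill ?\<rho> x)) - dom \<rho>)"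
        using x by (simp add: fill2)
      then show ?thesis using Suc by blast
    qed simp
  qed
qed

section \<open>Decision trees on finitely many variables\<close>

definition agree :: "'i set \<Rightarrow> ('i \<Rightarrow> bool) \<Rightarrow> ('i \<Rightarrow> bool) \<Rightarrow> bool" where
  "agree W x y \<longleftrightarrow> (\<forall>i\<in>W. y i = x i)"

lemma tree_cong:
  "agree (tree_vars T) x y \<Longrightarrow> tree_output T y = tree_output T x \<and> tree_queried T y = tree_queried T x"
  by (induction T) (auto simp: agree_def)

text \<open>The tree queries the variables of \<open>I\<close> one after another. The assignment
  \<open>z\<close> holds the values outside \<open>I\<close>; the induction needs it arbitrary,
  because each answer moves a variable from \<open>I\<close> to \<open>z\<close>.\<close>

lemma ex_tree_computes:
  assumes "finite I"
  shows "\<exists>T. tree_vars T \<subseteq> I \<and> (\<forall>x. agree (- I) z x \<longrightarrow> tree_output T x = f x)"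
  using assms
proof (induction I arbitrary: z)
  case empty
  have "x = z" if "agree (- {}) z x" for x using that by (auto simp: agree_def)
  then show ?case by (intro exI[of _ "Leaf (f z)"]) auto
next
  case (insert i I)
  obtain T where T: "\<And>b. tree_vars (T b) \<subseteq> I"
    "\<And>b x. agree (- I) (z(i := b)) x \<Longrightarrow> tree_output (T b) x = f x"
    using insert.IH[of "z(i := b)" for b] by metis
  have "tree_output (Query i (T False) (T True)) x = f x" if "agree (- insert i I) z x" for x
  proof -
    have "agree (- I) (z(i := x i)) x" using that by (auto simp: agree_def)
    then show ?thesis using T(2)[of "x i" x] by (cases "x i") auto
  qed
  moreover have "tree_vars (Query i (T False) (T True)) \<subseteq> insert i I" using T(1) by auto
  ultimately show ?case by blast
qed

lemma agree_restrict [simp]: "agree I x (restrict x I)" "agree I (restrict x I) x"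
  by (auto simp: agree_def)

lemma restrict_in_cube [simp]: "restrict x I \<in> cube I"
  by (auto simp: cube_def)

lemma finite_cube: "finite I \<Longrightarrow> finite (cube I)"
  by (auto simp: cube_def intro: finite_PiE)

lemma det_query_complexity_ge:
  assumes "finite I" and dep: "\<And>x y. agree I x y \<Longrightarrow> f y = f x" and "hard f d Map.empty"
  shows "d \<le> det_query_complexity I f"
proof -
  \<comment> \<open>Bounding an infimum of naturals from below requires a nonempty set of
    trees.\<close>
  have ex: "\<exists>T. tree_computes I T f"
  proof -
    obtain T where T: "tree_vars T \<subseteq> I"
      "\<And>x. agree (- I) (\<lambda>_. undefined) x \<Longrightarrow> tree_output T x = f x"
      using ex_tree_computes[OF assms(1)] by metis
    have "agree (- I) (\<lambda>_. undefined) x" if "x \<in> cube I" for x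
      using that by (auto simp: agree_def cube_def PiE_def extensional_def)
    then show ?thesis using T by (auto simp: tree_computes_def)
  qed
  moreover have "d \<le> tree_cost I T" if "tree_computes I T f" for T
  proof -
    have vars: "tree_vars T \<subseteq> I" using that by (simp add: tree_computes_def)
    \<comment> \<open>The tree is correct on the cube only, and its cost is a maximum over the cube,
      whereas the adversary produces a total assignment; restricting that assignment to
      \<open>I\<close> changes neither the run of the tree nor the value of
      \<open>f\<close>.\<close>
    have res: "agree (tree_vars T) x (restrict x I)" for x
      using vars by (auto simp: agree_def)
    have "tree_output T x = f x" for x
      using tree_cong[OF res[of x]] that dep[of x "restrict x I"]
      by (auto simp: tree_computes_def)
    then obtain x where "d \<le> card (tree_queried T x)"
      using hard_tree_queried[of T Map.empty f d] assms(3) by auto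
    then have "d \<le> card (tree_queried T (restrict x I))"
      using tree_cong[OF res[of x]] by simp
    also have "\<dots> \<le> tree_cost I T"
      unfolding tree_cost_def
      using finite_cube[OF assms(1)] by (intro Max_ge) auto
    finally show ?thesis .
  qed
  ultimately show ?thesis
    unfolding det_query_complexity_def by (intro cINF_greatest) auto
qed

section \<open>Certificates\<close>

text \<open>With \<open>u\<close> the certificates are unambiguous: the subcubes on which \<open>x\<close> is fixed on \<open>V x\<close>
  then partition the cube.\<close>

definition certf :: "bool \<Rightarrow> 'i set \<Rightarrow> nat \<Rightarrow> nat \<Rightarrow> (('i \<Rightarrow> bool) \<Rightarrow> bool) \<Rightarrow>
    (('i \<Rightarrow> bool) \<Rightarrow> 'i set) \<Rightarrow> bool" where
  "certf u I s0 s1 f V \<longleftrightarrow> (\<forall>x. V x \<subseteq> I \<and> card (V x) \<le> (if f x then s1 else s0) \<and>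
     (\<forall>y. agree (V x) x y \<longrightarrow> f y = f x \<and> (u \<longrightarrow> V y = V x)))"

lemma certfD:
  assumes "certf u I s0 s1 f V"
  shows "V x \<subseteq> I" "card (V x) \<le> (if f x then s1 else s0)"
    "agree (V x) x y \<Longrightarrow> f y = f x" "agree (V x) x y \<Longrightarrow> u \<Longrightarrow> V y = V x"
  using assms unfolding certf_def by blast+

lemma certf_depends:
  assumes "certf u I s0 s1 f V" "agree I x y"
  shows "f y = f x"
  using certfD(1,3)[OF assms(1)] assms(2) unfolding agree_def by blast

lemma if_not_swap: "(if \<not> P then a else b) = (if P then b else a)"
  by simp

lemma certf_not: "certf u I s0 s1 f V \<Longrightarrow> certf u I s1 s0 (\<lambda>x. \<not> f x) V"
  unfolding certf_def by (subst if_not_swap) blast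

lemma certf_mono:
  assumes "certf u I s0 s1 f V" "s0 \<le> t0" "s1 \<le> t1"
  shows "certf u I t0 t1 f V"
  unfolding certf_def
proof (intro allI conjI impI)
  fix x
  show "V x \<subseteq> I" by (rule certfD(1)[OF assms(1)])
  show "card (V x) \<le> (if f x then t1 else t0)"
    using certfD(2)[OF assms(1), of x] assms(2,3) by (cases "f x") auto
next
  fix x y assume "agree (V x) x y"
  then show "f y = f x" "u \<Longrightarrow> V y = V x"
    using certfD(3,4)[OF assms(1)] by blast+
qed

lemma certf_reindex:
  assumes "finite I" "certf u I s0 s1 f V"
  shows "certf u (h ` I) s0 s1 (\<lambda>x. f (\<lambda>i. x (h i))) (\<lambda>x. h ` V (\<lambda>i. x (h i)))"
  unfolding certf_def
proof (intro allI conjI impI)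
  fix x :: "'b \<Rightarrow> bool"
  let ?x = "\<lambda>i. x (h i)"
  show "h ` V ?x \<subseteq> h ` I" using certfD(1)[OF assms(2)] by blast
  have "finite (V ?x)" using certfD(1)[OF assms(2)] assms(1) by (rule finite_subset)
  then have "card (h ` V ?x) \<le> card (V ?x)" by (rule card_image_le)
  then show "card (h ` V ?x) \<le> (if f ?x then s1 else s0)"
    using certfD(2)[OF assms(2)] le_trans by blast
next
  fix x y assume "agree (h ` V (\<lambda>i. x (h i))) x y"
  then have "agree (V (\<lambda>i. x (h i))) (\<lambda>i. x (h i)) (\<lambda>i. y (h i))"
    by (auto simp: agree_def)
  then show "f (\<lambda>i. y (h i)) = f (\<lambda>i. x (h i))"
    "u \<Longrightarrow> h ` V (\<lambda>i. y (h i)) = h ` V (\<lambda>i. x (h i))"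
    using certfD(3,4)[OF assms(2)] by metis+
qed

section \<open>Conjunction of disjoint copies\<close>

definition conj_copies :: "nat \<Rightarrow> (('i \<Rightarrow> bool) \<Rightarrow> bool) \<Rightarrow> (nat \<times> 'i \<Rightarrow> bool) \<Rightarrow> bool" where
  "conj_copies n g x \<longleftrightarrow> (\<forall>j<n. g (\<lambda>i. x (j, i)))"

text \<open>Block \<open>j\<close> has its own budget \<open>e j\<close>, from which a query in that
  block is paid. A block without budget may be determined, but the second assumption keeps it
  satisfiable, so a block with budget left still decides the conjunction.\<close>

lemma hard_conj_copies_aux:
  assumes "\<And>j. j < n \<Longrightarrow> hard g (e j) (\<lambda>i. \<rho> (j, i))"
    and "\<And>j. j < n \<Longrightarrow> \<exists>x. g (fill (\<lambda>i. \<rho> (j, i)) x)"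
    and "d \<le> sum e {..<n}"
  shows "hard (conj_copies n g) d \<rho>"
  using assms
proof (induction d arbitrary: e \<rho>)
  case (Suc d)
  have block: "(\<lambda>i. fill \<rho> x (j, i)) = fill (\<lambda>i. \<rho> (j, i)) (\<lambda>i. x (j, i))" for x j
    by (auto simp: fill_def fun_eq_iff)
  obtain X where X: "\<And>j. j < n \<Longrightarrow> g (fill (\<lambda>i. \<rho> (j, i)) (X j))"
    using Suc.prems(2) by metis
  obtain j0 where j0: "j0 < n" "e j0 > 0"
    using Suc.prems(3) by (metis Suc_le_D lessThan_iff neq0_conv nat.distinct(1) sum.neutral)
  obtain y where y: "\<not> g (fill (\<lambda>i. \<rho> (j0, i)) y)"
    using hard_nonconst[OF Suc.prems(1)[OF j0(1)] j0(2)] by metis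
  have "conj_copies n g (fill \<rho> (\<lambda>(j, i). X j i))"
    using X by (simp add: conj_copies_def block)
  moreover have "\<not> conj_copies n g (fill \<rho> (\<lambda>(j, i). y i))"
    using y j0 by (auto simp: conj_copies_def block)
  moreover have "\<exists>b. hard (conj_copies n g) d (\<rho>(v \<mapsto> b))" if v: "\<rho> v = None" for v
  proof -
    obtain j i where ji: "v = (j, i)" by fastforce
    let ?\<rho> = "\<lambda>i. \<rho> (j, i)"
    have upd: "(\<lambda>i'. (\<rho>(v \<mapsto> b)) (j', i')) = (if j' = j then ?\<rho>(i \<mapsto> b) else (\<lambda>i'. \<rho> (j', i')))"
      for b j' using ji by (auto simp: fun_eq_iff)
    \<comment> \<open>With at least 2 units left, the adversary of the block answers, and the
      remaining unit keeps the block satisfiable. With fewer, the answer follows the satisfying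
      assignment \<open>X j\<close>.\<close>
    have "\<exists>b. j < n \<longrightarrow> hard g (e j - 1) (?\<rho>(i \<mapsto> b)) \<and> (\<exists>x. g (fill (?\<rho>(i \<mapsto> b)) x))"
    proof (cases "j < n \<and> e j \<ge> 2")
      case True
      then obtain d' where d': "e j = Suc (Suc d')" by (metis add_2_eq_Suc le_Suc_ex)
      then have "hard g (Suc (Suc d')) ?\<rho>"
        using Suc.prems(1)[of j] True by metis
      then obtain b where "hard g (Suc d') (?\<rho>(i \<mapsto> b))"
        using v ji unfolding hard.simps(2)[of g "Suc d'"] by blast
      then show ?thesis using d' hard_nonconst[of g "Suc d'"] by (metis diff_Suc_1 zero_less_Suc)
    next
      case False
      show ?thesis
      proof (cases "j < n")
        case True
        then have "g (fill (?\<rho>(i \<mapsto> fill ?\<rho> (X j) i)) (X j))"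
          using X[of j] by (simp only: fill_upd_self)
        moreover have "e j - 1 = 0" using False True by auto
        ultimately show ?thesis by (metis hard.simps(1))
      qed simp
    qed
    then obtain b where b: "j < n \<Longrightarrow> hard g (e j - 1) (?\<rho>(i \<mapsto> b))"
      "j < n \<Longrightarrow> \<exists>x. g (fill (?\<rho>(i \<mapsto> b)) x)" by blast
    have "d \<le> sum (e(j := e j - 1)) {..<n}"
    proof -
      have "sum e {..<n} \<le> Suc (sum (e(j := e j - 1)) {..<n})"
      proof (cases "j < n")
        case True
        then have "sum e {..<n} = e j + sum e ({..<n} - {j})"
          "sum (e(j := e j - 1)) {..<n} = (e j - 1) + sum (e(j := e j - 1)) ({..<n} - {j})"
          by (simp_all add: sum.remove)
        moreover have "sum (e(j := e j - 1)) ({..<n} - {j}) = sum e ({..<n} - {j})"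
          by (intro sum.cong) auto
        ultimately show ?thesis by linarith
      next
        case False
        then have "sum (e(j := e j - 1)) {..<n} = sum e {..<n}" by (intro sum.cong) auto
        then show ?thesis by simp
      qed
      then show ?thesis using Suc.prems(3) by linarith
    qed
    then have "hard (conj_copies n g) d (\<rho>(v \<mapsto> b))"
      using Suc.prems(1,2) b
      by (intro Suc.IH[of "e(j := e j - 1)"]) (simp_all only: upd, auto)
    then show ?thesis ..
  qed
  ultimately show ?case by auto
qed simp

lemma hard_conj_copies:
  assumes "hard g d Map.empty"
  shows "hard (conj_copies n g) (n * d) Map.empty"
proof (cases "d = 0")
  case False
  then obtain x where "g x" using hard_nonconst[OF assms] by auto
  then show ?thesis
    using assms by (intro hard_conj_copies_aux[where e = "\<lambda>_. d"]) auto
qed simp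

lemma agree_Sigma:
  "agree (Sigma J W) x y \<longleftrightarrow> (\<forall>j\<in>J. agree (W j) (\<lambda>i. x (j, i)) (\<lambda>i. y (j, i)))"
  by (auto simp: agree_def)

lemma card_Sigma_le:
  assumes "finite J" "\<And>j. j \<in> J \<Longrightarrow> finite (W j)" "\<And>j. j \<in> J \<Longrightarrow> card (W j) \<le> s" "card J \<le> n"
  shows "card (Sigma J W) \<le> n * s"
proof -
  have "card (Sigma J W) = (\<Sum>j\<in>J. card (W j))" using assms by simp
  also have "\<dots> \<le> card J * s" using assms(3) sum_bounded_above[of J "\<lambda>j. card (W j)" s] by simp
  also have "\<dots> \<le> n * s" using assms(4) by (rule mult_le_mono1)
  finally show ?thesis .
qed

lemma certf_conj_copies:
  fixes g :: "('i \<Rightarrow> bool) \<Rightarrow> bool"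
  assumes "finite I" and V: "certf False I s0 s1 g V"
  shows "\<exists>V'. certf False ({..<n} \<times> I) s0 (n * s1) (conj_copies n g) V'"
proof -
  have fin: "finite (V x)" for x
    using certfD(1)[OF V] assms(1) by (rule finite_subset)
  have "\<exists>W. W \<subseteq> {..<n} \<times> I \<and> card W \<le> (if conj_copies n g x then n * s1 else s0) \<and>
      (\<forall>y. agree W x y \<longrightarrow> conj_copies n g y = conj_copies n g x)" for x :: "nat \<times> 'i \<Rightarrow> bool"
  proof (cases "conj_copies n g x")
    case True
    then have one: "g (\<lambda>i. x (j, i))" if "j < n" for j using that by (simp add: conj_copies_def)
    let ?W = "SIGMA j:{..<n}. V (\<lambda>i. x (j, i))"
    have "card ?W \<le> n * s1"
      using fin certfD(2)[OF V] one by (intro card_Sigma_le) (auto split: if_splits, metis)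
    moreover have "conj_copies n g y" if "agree ?W x y" for y
      using that certfD(3)[OF V] one by (fastforce simp: agree_Sigma conj_copies_def)
    moreover have "?W \<subseteq> {..<n} \<times> I" using certfD(1)[OF V] by auto
    ultimately show ?thesis using True by (intro exI[of _ ?W]) auto
  next
    case False
    then obtain j where j: "j < n" "\<not> g (\<lambda>i. x (j, i))" by (auto simp: conj_copies_def)
    let ?W = "SIGMA j:{j}. V (\<lambda>i. x (j, i))"
    have "card ?W \<le> 1 * s0"
      using fin certfD(2)[OF V, of "\<lambda>i. x (j, i)"] j by (intro card_Sigma_le) auto
    moreover have "\<not> conj_copies n g y" if "agree ?W x y" for y
      using that certfD(3)[OF V, of "\<lambda>i. x (j, i)" "\<lambda>i. y (j, i)"] j
      by (auto simp: agree_Sigma conj_copies_def)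
    moreover have "?W \<subseteq> {..<n} \<times> I" using certfD(1)[OF V] j by auto
    ultimately show ?thesis using False by (intro exI[of _ ?W]) auto
  qed
  then show ?thesis unfolding certf_def by metis
qed

text \<open>The unambiguous certificate of a 0-input certifies all blocks up to the first block
  of value 0.\<close>

lemma ucertf_conj_copies:
  fixes g :: "('i \<Rightarrow> bool) \<Rightarrow> bool"
  assumes "finite I" and V: "certf True I s0 s1 g V"
  shows "\<exists>V'. certf True ({..<n} \<times> I) (n * s1 + s0) (n * s1) (conj_copies n g) V'"
proof
  define J where "J x = {j. j < n \<and> (\<forall>i<j. g (\<lambda>v. x (i, v)))}" for x :: "nat \<times> 'i \<Rightarrow> bool"
  define V' where "V' x = (SIGMA j:J x. V (\<lambda>v. x (j, v)))" for x
  have fin: "finite (V x)" for x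
    using certfD(1)[OF V] assms(1) by (rule finite_subset)
  have J: "J x \<subseteq> {..<n}" "finite (J x)" for x by (auto simp: J_def)
  then have cardJ: "card (J x) \<le> n" for x by (metis card_lessThan card_mono finite_lessThan)
  show "certf True ({..<n} \<times> I) (n * s1 + s0) (n * s1) (conj_copies n g) V'"
    unfolding certf_def
  proof (intro allI conjI impI)
    fix x
    show "V' x \<subseteq> {..<n} \<times> I" using J(1) certfD(1)[OF V] unfolding V'_def by blast
    show "card (V' x) \<le> (if conj_copies n g x then n * s1 else n * s1 + s0)"
    proof (cases "conj_copies n g x")
      case True
      then have "g (\<lambda>v. x (j, v))" if "j \<in> J x" for j
        using that J(1)[of x] by (auto simp: conj_copies_def)
      then have "card (V (\<lambda>v. x (j, v))) \<le> s1" if "j \<in> J x" for j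
        using certfD(2)[OF V, of "\<lambda>v. x (j, v)"] that by auto
      then show ?thesis
        using True card_Sigma_le[OF J(2) fin _ cardJ] unfolding V'_def by simp
    next
      case False
      let ?Z = "{j. j < n \<and> \<not> g (\<lambda>v. x (j, v))}"
      have Z: "?Z \<noteq> {}" using False by (auto simp: conj_copies_def)
      define j0 where "j0 = Min ?Z"
      have j0: "j0 < n" "\<not> g (\<lambda>v. x (j0, v))"
        using Min_in[OF _ Z] unfolding j0_def by auto
      have "g (\<lambda>v. x (j, v))" if "j \<in> J x - {j0}" for j
      proof (rule ccontr)
        assume "\<not> g (\<lambda>v. x (j, v))"
        then have "j0 \<le> j" using that J unfolding j0_def by (intro Min_le) auto
        then show False using that j0 by (auto simp: J_def)
      qed
      then have "card (SIGMA j:J x - {j0}. V (\<lambda>v. x (j, v))) \<le> n * s1"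
        using J fin cardJ[of x] certfD(2)[OF V]
        by (intro card_Sigma_le) (auto split: if_splits intro: le_trans[OF card_Diff1_le], metis)
      moreover have "card (SIGMA j:{j0}. V (\<lambda>v. x (j, v))) \<le> 1 * s0"
        using fin certfD(2)[OF V, of "\<lambda>v. x (j0, v)"] j0 by (intro card_Sigma_le) auto
      moreover have "V' x \<subseteq> (SIGMA j:J x - {j0}. V (\<lambda>v. x (j, v))) \<union> (SIGMA j:{j0}. V (\<lambda>v. x (j, v)))"
        by (auto simp: V'_def)
      then have "card (V' x) \<le> card (SIGMA j:J x - {j0}. V (\<lambda>v. x (j, v)))
          + card (SIGMA j:{j0}. V (\<lambda>v. x (j, v)))"
        using J fin by (intro order.trans[OF card_mono card_Un_le]) auto
      ultimately show ?thesis using False by simp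
    qed
  next
    fix x y assume "agree (V' x) x y"
    then have ag: "agree (V (\<lambda>v. x (j, v))) (\<lambda>v. x (j, v)) (\<lambda>v. y (j, v))" if "j \<in> J x" for j
      using that by (auto simp: V'_def agree_Sigma)
    \<comment> \<open>\<open>x\<close> and \<open>y\<close> have the same first 0-block: as long as
      all earlier blocks of \<open>x\<close> have value 1, the next block belongs to
      \<open>J x\<close> and its value is certified.\<close>
    have pre: "(\<forall>i<j. g (\<lambda>v. y (i, v))) = (\<forall>i<j. g (\<lambda>v. x (i, v)))" if "j \<le> n" for j
      using that
    proof (induction j)
      case (Suc j)
      have "g (\<lambda>v. y (j, v)) = g (\<lambda>v. x (j, v))" if "\<forall>i<j. g (\<lambda>v. x (i, v))"
        using that Suc.prems by (intro certfD(3)[OF V] ag) (auto simp: J_def)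
      then show ?case using Suc by (auto simp: less_Suc_eq)
    qed simp
    show "conj_copies n g y = conj_copies n g x" using pre[of n] by (simp add: conj_copies_def)
    have "J y = J x" unfolding J_def using pre by (intro Collect_cong conj_cong refl) simp
    then show "V' y = V' x"
      using certfD(4)[OF V ag] by (auto simp: V'_def)
  qed
qed

section \<open>Cheat sheets\<close>

text \<open>A description of certificates by \<open>m\<close> bits. Every bit string decodes to an
  admissible set, so following a pointer costs at most \<open>s\<close> queries even in a cell that
  holds no certificate.\<close>

definition decoder :: "'i set \<Rightarrow> nat \<Rightarrow> nat \<Rightarrow> ((nat \<Rightarrow> bool) \<Rightarrow> 'i set) \<Rightarrow> bool" where
  "decoder I s m D \<longleftrightarrow> (\<forall>w w'. agree {..<m} w w' \<longrightarrow> D w' = D w) \<and>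
     (\<forall>w. D w \<subseteq> I \<and> card (D w) \<le> s) \<and> (\<forall>W\<subseteq>I. card W \<le> s \<longrightarrow> (\<exists>w. D w = W))"

lemma decoderD:
  assumes "decoder I s m D"
  shows "agree {..<m} w w' \<Longrightarrow> D w' = D w" "D w \<subseteq> I" "card (D w) \<le> s"
    "W \<subseteq> I \<Longrightarrow> card W \<le> s \<Longrightarrow> \<exists>w. D w = W"
  using assms unfolding decoder_def by blast+

text \<open>A set of at most \<open>s\<close> elements arises from \<open>s\<close> successive
  choices, each of an element of \<open>I\<close> or of nothing.\<close>

lemma card_bounded_subsets:
  assumes "finite I"
  shows "finite {W. W \<subseteq> I \<and> card W \<le> s} \<and> card {W. W \<subseteq> I \<and> card W \<le> s} \<le> (card I + 1) ^ s"
proof (induction s)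
  case 0
  have "{W. W \<subseteq> I \<and> card W \<le> 0} = {{}}"
    using assms finite_subset by fastforce
  then show ?case by simp
next
  case (Suc s)
  let ?S = "\<lambda>s. {W. W \<subseteq> I \<and> card W \<le> s}"
  let ?A = "insert None (Some ` I)"
  let ?h = "\<lambda>(a, W). case a of None \<Rightarrow> W | Some i \<Rightarrow> insert i W"
  have "?S (Suc s) \<subseteq> ?h ` (?A \<times> ?S s)"
  proof
    fix W assume W: "W \<in> ?S (Suc s)"
    show "W \<in> ?h ` (?A \<times> ?S s)"
    proof (cases "W = {}")
      case True
      then show ?thesis by (intro image_eqI[of _ _ "(None, {})"]) auto
    next
      case False
      then obtain i where i: "i \<in> W" by blast
      have "finite W" using W assms finite_subset by blast
      then show ?thesis using i W
        by (intro image_eqI[of _ _ "(Some i, W - {i})"]) (auto simp: card_Diff_singleton)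
    qed
  qed
  then have "finite (?S (Suc s)) \<and> card (?S (Suc s)) \<le> card (?A \<times> ?S s)"
    using assms by (metis (no_types, lifting) finite_SigmaI finite_imageI finite_insert Suc.IH
        finite_subset surj_card_le)
  moreover have "card (?A \<times> ?S s) \<le> (card I + 1) ^ Suc s"
    using assms Suc.IH
    by (simp add: card_cartesian_product card_image card_insert_if del: mult_Suc)
  ultimately show ?case
    using le_trans by blast
qed

lemma ex_decoder:
  assumes "finite I" "card I + 1 \<le> 2 ^ b"
  shows "\<exists>D. decoder I s (s * b) D"
proof -
  let ?S = "{W. W \<subseteq> I \<and> card W \<le> s}"
  have "card ?S \<le> (card I + 1) ^ s" using card_bounded_subsets[OF assms(1)] by blast
  also have "\<dots> \<le> (2 ^ b) ^ s" using assms(2) by (rule power_mono) simp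
  also have "\<dots> = card (Pow {..<s * b})" by (simp add: card_Pow power_mult[symmetric] mult.commute)
  finally obtain e where e: "e ` ?S \<subseteq> Pow {..<s * b}" "inj_on e ?S"
    using card_bounded_subsets[OF assms(1)] card_le_inj[of ?S "Pow {..<s * b}"] by blast
  \<comment> \<open>\<open>D\<close> inverts the injection \<open>e\<close>; bit strings outside the
    image of \<open>e\<close> decode to the empty set, which is admissible.\<close>
  define D where "D w = (let B = {q. q < s * b \<and> w q} in
    if B \<in> e ` ?S then the_inv_into ?S e B else {})" for w :: "nat \<Rightarrow> bool"
  have D: "D w \<in> ?S" for w
    using the_inv_into_into[OF e(2), of "{q. q < s * b \<and> w q}" ?S]
    by (auto simp: D_def Let_def)
  have "D w' = D w" if "agree {..<s * b} w w'" for w w'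
  proof -
    have "{q. q < s * b \<and> w' q} = {q. q < s * b \<and> w q}" using that by (auto simp: agree_def)
    then show ?thesis by (simp only: D_def)
  qed
  moreover have "\<exists>w. D w = W" if "W \<in> ?S" for W
  proof
    have "{q. q < s * b \<and> q \<in> e W} = e W" using e(1) that by auto
    then show "D (\<lambda>q. q \<in> e W) = W"
      using that the_inv_into_f_f[OF e(2) that] by (simp add: D_def Let_def)
  qed
  moreover have "D w \<subseteq> I" "card (D w) \<le> s" for w using D[of w] by simp_all
  ultimately have "decoder I s (s * b) D" unfolding decoder_def by simp
  then show ?thesis by (intro exI[of _ D])
qed

text \<open>Variable \<open>Inl (j, i)\<close> is variable \<open>i\<close> of the \<open>j\<close>-th of the \<open>c\<close> inputs of \<open>g\<close>;
  \<open>Inr (l, j, q)\<close> is bit \<open>q\<close> of the description, in cell \<open>l\<close>, of a certificate for the \<open>j\<close>-th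
  input.\<close>

abbreviation copy :: "(nat \<times> 'i + bool list \<times> nat \<times> nat \<Rightarrow> bool) \<Rightarrow> nat \<Rightarrow> 'i \<Rightarrow> bool" where
  "copy x j \<equiv> \<lambda>i. x (Inl (j, i))"

definition address :: "(('i \<Rightarrow> bool) \<Rightarrow> bool) \<Rightarrow> nat \<Rightarrow>
    (nat \<times> 'i + bool list \<times> nat \<times> nat \<Rightarrow> bool) \<Rightarrow> bool list" where
  "address g c x = map (\<lambda>j. g (copy x j)) [0..<c]"

definition pointer :: "((nat \<Rightarrow> bool) \<Rightarrow> 'i set) \<Rightarrow> (('i \<Rightarrow> bool) \<Rightarrow> bool) \<Rightarrow> nat \<Rightarrow>
    (nat \<times> 'i + bool list \<times> nat \<times> nat \<Rightarrow> bool) \<Rightarrow> nat \<Rightarrow> 'i set" where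
  "pointer D g c x j = D (\<lambda>q. x (Inr (address g c x, j, q)))"

definition certifies :: "(('i \<Rightarrow> bool) \<Rightarrow> bool) \<Rightarrow> 'i set \<Rightarrow> ('i \<Rightarrow> bool) \<Rightarrow> bool" where
  "certifies g W x \<longleftrightarrow> (\<forall>y. agree W x y \<longrightarrow> g y = g x)"

text \<open>A cell stores only the positions of the certificates: what they certify is determined by the
  values of the input at these positions.\<close>

definition cheat :: "((nat \<Rightarrow> bool) \<Rightarrow> 'i set) \<Rightarrow> nat \<Rightarrow> (('i \<Rightarrow> bool) \<Rightarrow> bool) \<Rightarrow>
    (nat \<times> 'i + bool list \<times> nat \<times> nat \<Rightarrow> bool) \<Rightarrow> bool" where
  "cheat D c g x \<longleftrightarrow> (\<forall>j<c. certifies g (pointer D g c x j) (copy x j))"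

definition cheat_vars :: "'i set \<Rightarrow> nat \<Rightarrow> nat \<Rightarrow> (nat \<times> 'i + bool list \<times> nat \<times> nat) set" where
  "cheat_vars I c m = Inl ` ({..<c} \<times> I) \<union> Inr ` ({l. length l = c} \<times> {..<c} \<times> {..<m})"

lemma finite_bool_lists: "finite {l :: bool list. length l = c}"
  using finite_lists_length_eq[of "UNIV :: bool set" c] by simp

lemma card_bool_lists: "card {l :: bool list. length l = c} = 2 ^ c"
  using card_lists_length_eq[of "UNIV :: bool set" c] by simp

lemma finite_cheat_vars: "finite I \<Longrightarrow> finite (cheat_vars I c m)"
  by (simp add: cheat_vars_def finite_bool_lists)

lemma card_cheat_vars_le: "finite I \<Longrightarrow> card (cheat_vars I c m) \<le> c * card I + 2 ^ c * (c * m)"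
  unfolding cheat_vars_def
  by (rule order.trans[OF card_Un_le])
     (simp add: card_image card_cartesian_product card_bool_lists)

lemma card_le_Suc_if_subset_insert:
  assumes "A \<subseteq> insert a B" "finite B"
  shows "card A \<le> Suc (card B)"
proof -
  have "card A \<le> card (insert a B)" using assms by (intro card_mono) auto
  also have "\<dots> \<le> Suc (card B)" using assms(2) by (simp add: card_insert_if)
  finally show ?thesis .
qed

text \<open>Queries inside a copy of \<open>g\<close> are answered by the adversary for that copy,
  queries to cells by 1. A query takes at most one unit from a copy or touches one new cell, so
  while a unit is left, every copy is undetermined and some cell \<open>l\<close> is untouched. The
  copies can then be completed to have address \<open>l\<close>, and the content of cell
  \<open>l\<close> decides the value.\<close>

lemma hard_cheat:
  assumes D: "decoder I s m D" and V: "certf False I s s g V" and "c > 0"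
    and "\<And>j. j < c \<Longrightarrow> hard g d (\<lambda>i. \<rho> (Inl (j, i)))"
    and "d \<le> card {l. length l = c \<and> (\<forall>j q. \<rho> (Inr (l, j, q)) = None)}"
  shows "hard (cheat D c g) d \<rho>"
  using assms(4,5)
proof (induction d arbitrary: \<rho>)
  case (Suc d)
  let ?U = "\<lambda>\<rho> :: nat \<times> 'a + bool list \<times> nat \<times> nat \<rightharpoonup> bool.
    {l. length l = c \<and> (\<forall>j q. \<rho> (Inr (l, j, q)) = None)}"
  let ?\<rho> = "\<lambda>j i. \<rho> (Inl (j, i))"
  have finU: "finite (?U \<rho>)" for \<rho>
    using finite_bool_lists by (rule rev_finite_subset[of "{l. length l = c}"]) auto
  have "?U \<rho> \<noteq> {}" using Suc.prems(2) by (metis card.empty not_less_eq_eq zero_le)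
  then obtain l where l: "length l = c" "\<And>j q. \<rho> (Inr (l, j, q)) = None" by blast
  have nonconst: "\<exists>x. g (fill (?\<rho> j) x) = b" if "j < c" for j b
    using Suc.prems(1)[OF that] by (cases b) auto
  define X where "X j = (SOME x. g (fill (?\<rho> j) x) = l ! j)" for j
  have X: "g (fill (?\<rho> j) (X j)) = l ! j" if "j < c" for j
    unfolding X_def using nonconst[OF that] by (rule someI_ex)
  define z :: "(nat \<Rightarrow> nat \<Rightarrow> bool) \<Rightarrow> nat \<times> 'a + bool list \<times> nat \<times> nat \<Rightarrow> bool"
    where "z w = (\<lambda>v. case v of Inl (j, i) \<Rightarrow> X j i | Inr (l', j, q) \<Rightarrow> w j q)" for w
  have cpy: "copy (fill \<rho> (z w)) j = fill (?\<rho> j) (X j)" for w j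
    by (auto simp: fill_def z_def fun_eq_iff split: option.split)
  have adr: "address g c (fill \<rho> (z w)) = l" for w
    unfolding address_def cpy using l(1) X by (intro nth_equalityI) auto
  have ptr: "pointer D g c (fill \<rho> (z w)) j = D (w j)" for w j
    unfolding pointer_def adr by (simp add: fill_def l z_def)
  have "\<exists>w. D w = V (fill (?\<rho> j) (X j))" for j
    using certfD(1,2)[OF V] by (intro decoderD(4)[OF D]) auto
  then obtain w where w: "\<And>j. D (w j) = V (fill (?\<rho> j) (X j))"
    using choice[of "\<lambda>j w. D w = V (fill (?\<rho> j) (X j))"] by blast
  have "cheat D c g (fill \<rho> (z w))"
    unfolding cheat_def ptr cpy w certifies_def using certfD(3)[OF V] by blast
  \<comment> \<open>The empty set certifies nothing, as \<open>g\<close> is not constant; since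
    there is at least one copy, describing the empty set in cell \<open>l\<close> gives a
    0-input.\<close>
  moreover obtain w0 where w0: "D w0 = {}" using decoderD(4)[OF D, of "{}"] by auto
  have "\<exists>y. g y \<noteq> g (fill (?\<rho> 0) (X 0))"
    using nonconst[OF \<open>c > 0\<close>, of "\<not> g (fill (?\<rho> 0) (X 0))"] by blast
  then have "\<not> cheat D c g (fill \<rho> (z (\<lambda>_. w0)))"
    unfolding cheat_def ptr cpy w0 certifies_def using \<open>c > 0\<close> by (auto simp: agree_def)
  moreover have "\<exists>b. hard (cheat D c g) d (\<rho>(v \<mapsto> b))" if v: "\<rho> v = None" for v
  proof (cases v)
    case (Inl p)
    obtain j i where p: "p = (j, i)" by fastforce
    have upd: "(\<lambda>i'. (\<rho>(v \<mapsto> b)) (Inl (j', i'))) = (if j' = j then (?\<rho> j)(i \<mapsto> b) else ?\<rho> j')"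
      for b j' using Inl p by (auto simp: fun_eq_iff)
    have "\<exists>b. j < c \<longrightarrow> hard g d ((?\<rho> j)(i \<mapsto> b))"
      using Suc.prems(1)[of j] v Inl p by auto
    then obtain b where b: "j < c \<longrightarrow> hard g d ((?\<rho> j)(i \<mapsto> b))" by blast
    have "hard g d (\<lambda>i'. (\<rho>(v \<mapsto> b)) (Inl (j', i')))" if "j' < c" for j'
      unfolding upd using b hard_SucD[OF Suc.prems(1)[OF that]] that by simp
    moreover have "?U (\<rho>(v \<mapsto> b)) = ?U \<rho>" using Inl by simp
    then have "d \<le> card (?U (\<rho>(v \<mapsto> b)))" using Suc.prems(2) by simp
    ultimately have "hard (cheat D c g) d (\<rho>(v \<mapsto> b))"
      by (intro Suc.IH)
    then show ?thesis ..
  next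
    case (Inr p)
    obtain l' j q where p: "p = (l', j, q)" by (metis surj_pair)
    have "?U \<rho> \<subseteq> insert l' (?U (\<rho>(v \<mapsto> True)))" using Inr p by auto
    then have "card (?U \<rho>) \<le> Suc (card (?U (\<rho>(v \<mapsto> True))))"
      using finU by (rule card_le_Suc_if_subset_insert)
    then have "d \<le> card (?U (\<rho>(v \<mapsto> True)))" using Suc.prems(2) by linarith
    moreover have "hard g d (\<lambda>i. (\<rho>(v \<mapsto> True)) (Inl (j, i)))" if "j < c" for j
      using hard_SucD[OF Suc.prems(1)[OF that]] Inr by simp
    ultimately have "hard (cheat D c g) d (\<rho>(v \<mapsto> True))"
      by (intro Suc.IH)
    then show ?thesis ..
  qed
  ultimately show ?case by auto
qed simp

text \<open>For a 1-input the addressed cell and the positions it points to suffice: they certify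
  the values of all copies, hence the address itself. For a 0-input the cell may be wrong, so the
  certificates \<open>V\<close> of all copies are added. Their size \<open>t\<close> enters only the
  bound for 0-inputs and may be far larger than \<open>s\<close>.\<close>

lemma certf_cheat:
  fixes g :: "('i \<Rightarrow> bool) \<Rightarrow> bool"
  assumes "finite I" and D: "decoder I s m D" and V: "certf u I t t g V"
  shows "\<exists>V'. certf u (cheat_vars I c m) (c * (m + s) + c * t) (c * (m + s)) (cheat D c g) V'"
proof
  let ?g = "cheat D c g"
  define W where "W x = Inr ` ({address g c x} \<times> {..<c} \<times> {..<m})
    \<union> Inl ` (SIGMA j:{..<c}. pointer D g c x j)" for x
  define U :: "(nat \<times> 'i + bool list \<times> nat \<times> nat \<Rightarrow> bool) \<Rightarrow> (nat \<times> 'i + bool list \<times> nat \<times> nat) set"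
    where "U x = Inl ` (SIGMA j:{..<c}. V (copy x j))" for x
  define V' where "V' x = (if ?g x then W x else W x \<union> U x)" for x
  have finD: "finite (pointer D g c x j)" for x j
    unfolding pointer_def using decoderD(2)[OF D] assms(1) by (rule finite_subset)
  have finV: "finite (V x)" for x
    using certfD(1)[OF V] assms(1) by (rule finite_subset)
  have "W x \<subseteq> cheat_vars I c m" for x
    using decoderD(2)[OF D] unfolding W_def cheat_vars_def pointer_def
    by (auto simp: address_def)
  moreover have "U x \<subseteq> cheat_vars I c m" for x
    using certfD(1)[OF V] unfolding U_def cheat_vars_def by auto
  ultimately have sub: "V' x \<subseteq> cheat_vars I c m" for x
    by (simp add: V'_def)
  have cardW: "card (W x) \<le> c * (m + s)" for x
  proof -
    have "card (SIGMA j:{..<c}. pointer D g c x j) \<le> c * s"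
      using finD decoderD(3)[OF D] by (intro card_Sigma_le) (auto simp: pointer_def)
    then show ?thesis unfolding W_def
      by (intro order.trans[OF card_Un_le])
         (simp add: card_image card_cartesian_product distrib_left)
  qed
  have cardU: "card (U x) \<le> c * t" for x
  proof -
    have "card (SIGMA j:{..<c}. V (copy x j)) \<le> c * t"
      using finV certfD(2)[OF V] by (intro card_Sigma_le) auto
    then show ?thesis unfolding U_def by (simp add: card_image)
  qed
  have "card (V' x) \<le> (if ?g x then c * (m + s) else c * (m + s) + c * t)" for x
    using cardW[of x] cardU[of x] card_Un_le[of "W x" "U x"] by (auto simp: V'_def)
  moreover have "?g y = ?g x \<and> (u \<longrightarrow> V' y = V' x)" if ag: "agree (V' x) x y" for x y
  proof -
    have agW: "agree (W x) x y" and agU: "\<not> ?g x \<Longrightarrow> agree (U x) x y"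
      using ag by (auto simp: V'_def agree_def split: if_splits)
    have agp: "agree (pointer D g c x j) (copy x j) (copy y j)" if "j < c" for j
      using agW that by (auto simp: W_def agree_def)
    have agV: "agree (V (copy x j)) (copy x j) (copy y j)" if "j < c" "\<not> ?g x" for j
      using agU that by (auto simp: U_def agree_def)
    \<comment> \<open>The values of the copies come first: only once the addresses agree do
      \<open>x\<close> and \<open>y\<close> read the same cell, and hence the same pointers.\<close>
    have val: "g (copy y j) = g (copy x j)" if "j < c" for j
    proof (cases "?g x")
      case True
      then show ?thesis using agp[OF that] that by (auto simp: cheat_def certifies_def)
    next
      case False
      then show ?thesis using certfD(3)[OF V] agV[OF that] by blast
    qed
    then have adr: "address g c y = address g c x" by (auto simp: address_def)
    have ptr: "pointer D g c y j = pointer D g c x j" if "j < c" for j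
      unfolding pointer_def adr
      using agW that by (intro decoderD(1)[OF D]) (auto simp: W_def agree_def)
    have "certifies g (pointer D g c y j) (copy y j) = certifies g (pointer D g c x j) (copy x j)"
      if "j < c" for j
      using agp[OF that] val[OF that] unfolding ptr[OF that] certifies_def agree_def by metis
    then have eq: "?g y = ?g x" by (auto simp: cheat_def)
    have "W y = W x" unfolding W_def adr using ptr by auto
    moreover have "U y = U x" if u "\<not> ?g x"
      using certfD(4)[OF V agV] that by (auto simp: U_def)
    ultimately show ?thesis using eq by (auto simp: V'_def)
  qed
  ultimately show "certf u (cheat_vars I c m) (c * (m + s) + c * t) (c * (m + s)) ?g V'"
    using sub unfolding certf_def by blast
qed

section \<open>Inputs without small certificates\<close>

lemma card_ge_if_certifies_conj_copies:
  assumes "g x1" "\<not> g x0" "finite W" "certifies (conj_copies n g) W (\<lambda>(j, i). x1 i)"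
  shows "n \<le> card W"
proof -
  have "{..<n} \<subseteq> fst ` W"
  proof
    fix j assume "j \<in> {..<n}"
    show "j \<in> fst ` W"
    proof (rule ccontr)
      assume j: "j \<notin> fst ` W"
      \<comment> \<open>If \<open>W\<close> misses block \<open>j\<close>, changing that block to
        the 0-input \<open>x0\<close> goes unnoticed but changes the value.\<close>
      let ?y = "\<lambda>(j', i). if j' = j then x0 i else x1 i"
      have "agree W (\<lambda>(j, i). x1 i) ?y" using j by (force simp: agree_def)
      then have "conj_copies n g ?y = conj_copies n g (\<lambda>(j, i). x1 i)"
        using assms(4) unfolding certifies_def by blast
      then show False using assms(1,2) \<open>j \<in> {..<n}\<close> by (auto simp: conj_copies_def)
    qed
  qed
  then have "card {..<n} \<le> card W" using assms(3) by (rule surj_card_le[rotated])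
  then show ?thesis by simp
qed

text \<open>This makes the subcube partition complexity tend to infinity, since a subcube of the
  partition that contains \<open>z\<close> certifies the value at \<open>z\<close>. Finiteness of
  \<open>W\<close> is demanded because \<open>card\<close> is 0 on infinite sets.\<close>

definition min_cert_ge :: "nat \<Rightarrow> (('i \<Rightarrow> bool) \<Rightarrow> bool) \<Rightarrow> bool" where
  "min_cert_ge n f \<longleftrightarrow> (\<exists>z. \<forall>W. finite W \<longrightarrow> certifies f W z \<longrightarrow> n \<le> card W)"

lemma min_cert_ge_conj_copies:
  assumes "hard g d Map.empty" "d > 0"
  shows "min_cert_ge n (conj_copies n g)"
proof -
  obtain x1 x0 where "g x1" "\<not> g x0" using hard_nonconst[OF assms] by auto
  then show ?thesis
    unfolding min_cert_ge_def
    by (intro exI[of _ "\<lambda>(j, i). x1 i"] allI impI card_ge_if_certifies_conj_copies)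
qed

lemma min_cert_ge_reindex:
  assumes h: "inj h" and "min_cert_ge n f"
  shows "min_cert_ge n (\<lambda>x. f (\<lambda>i. x (h i)))"
proof -
  obtain z where z: "\<And>W. finite W \<Longrightarrow> certifies f W z \<Longrightarrow> n \<le> card W"
    using assms(2) unfolding min_cert_ge_def by blast
  let ?z = "z \<circ> inv h"
  have pull: "(\<lambda>i. ?z (h i)) = z" using h by auto
  have "n \<le> card W" if W: "finite W" "certifies (\<lambda>x. f (\<lambda>i. x (h i))) W ?z" for W
  proof -
    have "certifies f (h -` W) z"
      unfolding certifies_def
    proof (intro allI impI)
      fix y assume y: "agree (h -` W) z y"
      let ?y = "\<lambda>v. if v \<in> range h then y (inv h v) else ?z v"
      have "agree W ?z ?y" using y h by (auto simp: agree_def)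
      moreover have "(\<lambda>i. ?y (h i)) = y" using h by auto
      moreover have "f (\<lambda>i. ?y (h i)) = f (\<lambda>i. ?z (h i))"
        using W(2) \<open>agree W ?z ?y\<close> unfolding certifies_def by blast
      ultimately show "f y = f z" by (simp only: pull)
    qed
    moreover have "finite (h -` W)" using W(1) h by (rule finite_vimageI)
    ultimately have "n \<le> card (h -` W)" using z by blast
    also have "\<dots> \<le> card W" using card_vimage_inj_on_le[OF h W(1)] by simp
    finally show ?thesis .
  qed
  then show ?thesis unfolding min_cert_ge_def by blast
qed

text \<open>Cheat sheets and conjunctions change the type of the variables. Renaming them to natural
  numbers after each conjunction keeps all stages on one type, so that the iteration can be an
  induction.\<close>

lemma ex_conj_copies_nat:
  fixes g :: "('i :: countable \<Rightarrow> bool) \<Rightarrow> bool"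
  assumes "finite I" "hard g d Map.empty" "d > 0"
    and "certf False I s0 s1 g V" "certf True I t0 t1 g V'"
  shows "\<exists>(J :: nat set) f. finite J \<and> card J \<le> n * card I \<and> hard f (n * d) Map.empty \<and>
    (\<exists>V. certf False J s0 (n * s1) f V) \<and> (\<exists>V. certf True J (n * t1 + t0) (n * t1) f V) \<and>
    min_cert_ge n f"
proof -
  let ?h = "to_nat :: nat \<times> 'i \<Rightarrow> nat"
  let ?I = "{..<n} \<times> I"
  let ?f = "\<lambda>x. conj_copies n g (\<lambda>i. x (?h i))"
  have fin: "finite ?I" using assms(1) by simp
  have inj: "inj ?h" by simp
  have "finite (?h ` ?I)" using fin by simp
  moreover have "card (?h ` ?I) \<le> n * card I"
    using card_image_le[OF fin, of ?h] by (simp add: card_cartesian_product)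
  moreover have "hard ?f (n * d) Map.empty"
    using hard_conj_copies[OF assms(2)] by (rule hard_reindex[OF inj])
  moreover have "min_cert_ge n ?f"
    using min_cert_ge_conj_copies[OF assms(2,3)] by (rule min_cert_ge_reindex[OF inj])
  moreover obtain U where "certf False ?I s0 (n * s1) (conj_copies n g) U"
    using certf_conj_copies[OF assms(1,4)] by blast
  note certf_reindex[OF fin this, of ?h]
  moreover obtain U' where "certf True ?I (n * t1 + t0) (n * t1) (conj_copies n g) U'"
    using ucertf_conj_copies[OF assms(1,5)] by blast
  note certf_reindex[OF fin this, of ?h]
  ultimately show ?thesis by blast
qed

section \<open>Iteration\<close>

text \<open>Here \<open>2 ^ L\<close> is the fan-in \<open>n\<close> of the conjunctions, and \<open>L ^ a\<close> absorbs the
  polylogarithmic losses.\<close>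

definition stage :: "nat \<Rightarrow> nat \<Rightarrow> nat \<Rightarrow> nat set \<Rightarrow> ((nat \<Rightarrow> bool) \<Rightarrow> bool) \<Rightarrow> bool" where
  "stage k a L I f \<longleftrightarrow> finite I \<and> card I \<le> 2 ^ (a * L) \<and>
    hard f ((2 ^ L) ^ (2 * k + 1)) Map.empty \<and>
    (\<exists>V. certf False I (L ^ a * (2 ^ L) ^ k) (L ^ a * (2 ^ L) ^ (k + 1)) f V) \<and>
    (\<exists>V. certf True I (L ^ a * (2 ^ L) ^ (k + 1)) (L ^ a * (2 ^ L) ^ (k + 1)) f V) \<and>
    min_cert_ge (2 ^ L) f"

lemma stage_0:
  assumes "L \<ge> 2"
  shows "\<exists>I f. stage 0 1 L I f"
proof -
  define g where "g = (\<lambda>x :: nat \<Rightarrow> bool. x 0)"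
  have "hard g 1 Map.empty" by (auto simp: g_def)
  moreover have "certf u {0} 1 1 g (\<lambda>_. {0})" for u
    by (auto simp: certf_def g_def agree_def)
  ultimately obtain J :: "nat set" and f V U where f: "finite J" "card J \<le> 2 ^ L * card {0 :: nat}"
    "hard f (2 ^ L * 1) Map.empty" "certf False J 1 (2 ^ L * 1) f V"
    "certf True J (2 ^ L * 1 + 1) (2 ^ L * 1) f U" "min_cert_ge (2 ^ L) f"
    using ex_conj_copies_nat[of "{0}" g 1 1 1 _ 1 1 _ "2 ^ L"]
    by (metis finite.emptyI finite.insertI zero_less_one)
  \<comment> \<open>The unambiguous certificates of 0-inputs have size up to
    \<open>2 ^ L + 1\<close>; the factor \<open>L\<close> absorbs the 1.\<close>
  have le: "2 ^ L + 1 \<le> L * 2 ^ L"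
  proof -
    have "2 ^ L + 1 \<le> 2 * (2 ^ L :: nat)" by simp
    also have "\<dots> \<le> L * 2 ^ L" using assms by (rule mult_le_mono1)
    finally show ?thesis .
  qed
  have "certf False J (L ^ 1 * (2 ^ L) ^ 0) (L ^ 1 * (2 ^ L) ^ (0 + 1)) f V"
    using le assms by (intro certf_mono[OF f(4)]) auto
  moreover have "certf True J (L ^ 1 * (2 ^ L) ^ (0 + 1)) (L ^ 1 * (2 ^ L) ^ (0 + 1)) f U"
    using le assms by (intro certf_mono[OF f(5)]) auto
  ultimately have "stage 0 1 L J f"
    using f(1,2,3,6) by (auto simp: stage_def)
  then show ?thesis by blast
qed

lemma le_power_self: "L \<ge> (2 :: nat) \<Longrightarrow> x \<le> L ^ x"
proof -
  assume "L \<ge> 2"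
  then have "2 ^ x \<le> L ^ x" by (intro power_mono) simp_all
  then show ?thesis using less_exp[of x] by linarith
qed

lemma stage_Suc:
  assumes L: "L \<ge> 2" and stage: "stage k a L I f"
  shows "\<exists>I' f'. stage (Suc k) (a + 2 + (4 * k + 4) * (a + 3) + (2 * a + 5 * k + 9)) L I' f'"
proof -
  define n :: nat where "n = 2 ^ L"
  define s where "s = L ^ a * n ^ (k + 1)"
  \<comment> \<open>This gives \<open>2 ^ c = n ^ (2 * k + 2)\<close> cells, as many as the
    adversary for \<open>g\<close> has units, so the cells do not run out first.\<close>
  define c where "c = (2 * k + 2) * L"
  \<comment> \<open>By \<open>cardJ\<close> below, \<open>b\<close> bits can describe one position
    of a certificate, hence \<open>m\<close> bits up to \<open>s\<close> positions.\<close>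
  define b where "b = (a + 2) * L"
  define m where "m = s * b"
  \<comment> \<open>The part \<open>a + 2 + (4 * k + 4) * (a + 3)\<close> serves the polylogarithmic
    factors in \<open>La\<close>, the part \<open>2 * a + 5 * k + 9\<close> the number of variables
    in \<open>card\<close>.\<close>
  define a' where "a' = a + 2 + (4 * k + 4) * (a + 3) + (2 * a + 5 * k + 9)"
  have n: "n > 0" by (simp add: n_def)
  have npow: "n ^ e = 2 ^ (e * L)" for e
    by (simp only: n_def power_mult[symmetric] mult.commute)
  have "c > 0" using L by (simp add: c_def)
  obtain V U where f: "finite I" "card I \<le> 2 ^ (a * L)" "hard f (n ^ (2 * k + 1)) Map.empty"
    "certf False I (L ^ a * n ^ k) s f V" "certf True I s s f U"
    using stage unfolding stage_def n_def s_def by blast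
  obtain J :: "nat set" and g W X where J: "finite J" "card J \<le> n * card I"
    "hard g (n * n ^ (2 * k + 1)) Map.empty"
    "certf False J s (n * (L ^ a * n ^ k)) g W" "certf True J (n * s + s) (n * s) g X"
    using ex_conj_copies_nat[OF f(1) hard_not[OF f(3)] _ certf_not[OF f(4)] certf_not[OF f(5)], of n]
      n by auto
  \<comment> \<open>Negation makes the shorter certificates of \<open>f\<close> those that the
    conjunction multiplies by \<open>n\<close>, which balances both sides at
    \<open>s\<close>.\<close>
  have W: "certf False J s s g W"
    by (rule certf_mono[OF J(4)]) (simp_all add: s_def algebra_simps)
  have X: "certf True J (2 * n * s) (2 * n * s) g X"
    using n by (intro certf_mono[OF J(5)]) simp_all
  have cardJ: "card J + 1 \<le> 2 ^ b"
  proof -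
    have "card J \<le> 2 ^ L * 2 ^ (a * L)"
      using J(2) mult_le_mono2[OF f(2), of "2 ^ L"] unfolding n_def by (rule order.trans)
    moreover have "1 \<le> 2 ^ L * (2 :: nat) ^ (a * L)" by simp
    ultimately have "card J + 1 \<le> 2 * (2 ^ L * 2 ^ (a * L))" by linarith
    also have "\<dots> \<le> 2 ^ L * (2 ^ L * 2 ^ (a * L))"
      using L power_increasing[of 1 L "2 :: nat"] by (intro mult_le_mono1) simp
    also have "\<dots> = 2 ^ b"
      unfolding power_add[symmetric]
      by (rule arg_cong[of _ _ "power 2"]) (simp add: b_def algebra_simps)
    finally show ?thesis .
  qed
  obtain D where D: "decoder J s m D"
    using ex_decoder[OF J(1) cardJ] unfolding m_def by blast
  let ?K = "cheat_vars J c m" and ?h = "cheat D c g"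
  have "2 ^ c = n ^ (2 * k + 2)"
    by (simp only: npow c_def)
  then have hard: "hard ?h (n ^ (2 * k + 2)) Map.empty"
    using J(3) \<open>c > 0\<close> by (intro hard_cheat[OF D W]) (simp_all add: card_bool_lists)
  \<comment> \<open>The same cheat sheet is used with the ordinary certificates \<open>W\<close> and
    with the longer unambiguous ones \<open>X\<close>. The extra factor \<open>n\<close> of
    \<open>X\<close> appears only for 0-inputs, a cost that the outer conjunction incurs once and
    not \<open>n\<close> times.\<close>
  obtain Y Z where Y: "certf False ?K (c * (m + s) + c * s) (c * (m + s)) ?h Y"
    and Z: "certf True ?K (c * (m + s) + c * (2 * n * s)) (c * (m + s)) ?h Z"
    using certf_cheat[OF J(1) D W] certf_cheat[OF J(1) D X] by blast
  obtain I' :: "nat set" and f' V' U' where f': "finite I'" "card I' \<le> n * card ?K"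
    "hard f' (n * n ^ (2 * k + 2)) Map.empty"
    "certf False I' (c * (m + s) + c * s) (n * (c * (m + s))) f' V'"
    "certf True I' (n * (c * (m + s)) + (c * (m + s) + c * (2 * n * s))) (n * (c * (m + s))) f' U'"
    "min_cert_ge n f'"
    using ex_conj_copies_nat[OF finite_cheat_vars[OF J(1)] hard _ Y Z, of n] n by auto
  have La: "2 * c * (b + 2) * L ^ a \<le> L ^ a'"
  proof -
    have "b + 2 \<le> (a + 3) * L" using L by (simp add: b_def algebra_simps)
    then have "2 * c * (b + 2) * L ^ a \<le> 2 * c * ((a + 3) * L) * L ^ a"
      by (intro mult_le_mono1 mult_le_mono2)
    also have "\<dots> = (4 * k + 4) * (a + 3) * L ^ (a + 2)"
      by (simp add: c_def algebra_simps)
    also have "\<dots> \<le> L ^ ((4 * k + 4) * (a + 3)) * L ^ (a + 2)"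
      by (intro mult_le_mono1 le_power_self L)
    also have "\<dots> \<le> L ^ a'"
      unfolding power_add[symmetric] using L by (intro power_increasing) (simp_all add: a'_def)
    finally show ?thesis .
  qed
  have s': "2 * c * (b + 2) * s \<le> L ^ a' * n ^ (k + 1)"
    using mult_le_mono1[OF La, of "n ^ (k + 1)"] by (simp add: s_def mult.assoc)
  have ms: "m + s = s * (b + 1)" by (simp add: m_def)
  have 0: "c * (m + s) + c * s \<le> L ^ a' * n ^ (k + 1)"
  proof -
    have "c * (m + s) + c * s = c * (b + 2) * s" by (simp add: ms algebra_simps)
    also have "\<dots> \<le> 2 * c * (b + 2) * s" by simp
    finally show ?thesis using s' by (rule order.trans)
  qed
  have 1: "n * (c * (m + s)) + (c * (m + s) + c * (2 * n * s)) \<le> L ^ a' * n ^ (k + 2)"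
  proof -
    have "c * (m + s) \<le> n * (c * (m + s))" using n by simp
    then have "n * (c * (m + s)) + (c * (m + s) + c * (2 * n * s))
        \<le> n * (c * (m + s)) + (n * (c * (m + s)) + c * (2 * n * s))" by linarith
    also have "\<dots> = n * (2 * c * (b + 2) * s)" by (simp add: ms algebra_simps)
    also have "\<dots> \<le> n * (L ^ a' * n ^ (k + 1))" using s' by (rule mult_le_mono2)
    finally show ?thesis by (simp add: algebra_simps)
  qed
  have 2: "n * (c * (m + s)) \<le> L ^ a' * n ^ (k + 2)"
    using 1 by (rule add_leD1)
  have card: "card I' \<le> 2 ^ (a' * L)"
  proof -
    let ?e = "(a + k + 1) * L + b"
    have cc: "c \<le> 2 ^ c" by (rule less_imp_le[OF less_exp])
    have "s \<le> 2 ^ ((a + k + 1) * L)"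
    proof -
      have "L ^ a \<le> n ^ a" unfolding n_def by (intro power_mono less_imp_le[OF less_exp]) simp
      then have "s \<le> n ^ a * n ^ (k + 1)" unfolding s_def by (rule mult_le_mono1)
      also have "\<dots> = 2 ^ ((a + k + 1) * L)"
        by (simp only: power_add[symmetric] npow add.assoc add_mult_distrib)
      finally show ?thesis .
    qed
    moreover have "b \<le> 2 ^ b" by (rule less_imp_le[OF less_exp])
    ultimately have m: "m \<le> 2 ^ ?e" unfolding m_def power_add by (rule mult_le_mono)
    have "card J \<le> 2 ^ b" using cardJ by simp
    also have "\<dots> \<le> 2 ^ c * 2 ^ ?e"
      unfolding power_add[symmetric] by (intro power_increasing) simp_all
    finally have "c * card J \<le> 2 ^ c * (2 ^ c * 2 ^ ?e)" using cc by (intro mult_le_mono)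
    moreover have "2 ^ c * (c * m) \<le> 2 ^ c * (2 ^ c * 2 ^ ?e)"
      using cc m by (intro mult_le_mono2 mult_le_mono)
    ultimately have "card ?K \<le> 2 * (2 ^ c * (2 ^ c * 2 ^ ?e))"
      using card_cheat_vars_le[OF J(1), of c m] by linarith
    also have "\<dots> \<le> 2 ^ L * (2 ^ c * (2 ^ c * 2 ^ ?e))"
      using L power_increasing[of 1 L "2 :: nat"] by (intro mult_le_mono1) simp
    finally have "n * card ?K \<le> 2 ^ L * (2 ^ L * (2 ^ c * (2 ^ c * 2 ^ ?e)))"
      unfolding n_def by (rule mult_le_mono2)
    also have "\<dots> = 2 ^ ((2 * a + 5 * k + 9) * L)"
      unfolding power_add[symmetric]
      by (rule arg_cong[of _ _ "power 2"]) (simp add: c_def b_def algebra_simps)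
    also have "\<dots> \<le> 2 ^ (a' * L)"
      by (intro power_increasing mult_le_mono1) (simp_all add: a'_def)
    finally show ?thesis using f'(2) by (rule order.trans[rotated])
  qed
  have "certf False I' (L ^ a' * n ^ Suc k) (L ^ a' * n ^ (Suc k + 1)) f' V'"
    using 0 2 unfolding add_2_eq_Suc' Suc_eq_plus1[symmetric] by (rule certf_mono[OF f'(4)])
  moreover have "certf True I' (L ^ a' * n ^ (Suc k + 1)) (L ^ a' * n ^ (Suc k + 1)) f' U'"
    using 1 2 unfolding add_2_eq_Suc' Suc_eq_plus1[symmetric] by (rule certf_mono[OF f'(5)])
  moreover have "hard f' (n ^ (2 * Suc k + 1)) Map.empty" using f'(3) by simp
  ultimately have "stage (Suc k) a' L I' f'"
    using f'(1,6) card unfolding stage_def n_def[symmetric] by blast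
  then show ?thesis unfolding a'_def by blast
qed

text \<open>The exponent \<open>a\<close> depends on \<open>k\<close> alone, so \<open>L\<close> can
  later be chosen so large that \<open>2 ^ L\<close> dominates the powers of
  \<open>L\<close>.\<close>

lemma ex_stage: "\<exists>a. \<forall>L\<ge>2. \<exists>I f. stage k a L I f"
proof (induction k)
  case 0
  show ?case using stage_0 by blast
next
  case (Suc k)
  then show ?case using stage_Suc by metis
qed

section \<open>Subcube partitions\<close>

text \<open>The cell of \<open>x\<close> consists of the inputs agreeing with \<open>x\<close> on
  \<open>V x\<close>. By unambiguity, two cells with a common input \<open>y\<close> are both given
  by the values of \<open>y\<close> on \<open>V y\<close>, hence coincide.\<close>

lemma subcube_partition_certf:
  assumes V: "certf True I s s f V" and "finite J" "I \<subseteq> J"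
  shows "\<exists>P. subcube_partition J f s P"
proof
  define cell where "cell x = {y \<in> cube J. agree (V x) x y}" for x
  have self: "x \<in> cell x" if "x \<in> cube J" for x using that by (simp add: cell_def agree_def)
  have "partition_on (cube J) (cell ` cube J)"
  proof (rule partition_onI)
    show "\<Union> (cell ` cube J) = cube J" using self by (auto simp: cell_def)
    show "{} \<notin> cell ` cube J" using self by blast
    show "disjnt C C'" if C: "C \<in> cell ` cube J" "C' \<in> cell ` cube J" "C \<noteq> C'" for C C'
    proof -
      obtain x x' where x: "C = cell x" "C' = cell x'" using C by blast
      have "C = C'" if y: "y \<in> C" "y \<in> C'" for y
      proof -
        have ag: "agree (V x) x y" "agree (V x') x' y" using y x by (auto simp: cell_def)
        then have "V x = V y" "V x' = V y" using certfD(4)[OF V] by metis+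
        then show ?thesis using x ag by (auto simp: cell_def agree_def)
      qed
      then show ?thesis using C(3) by (auto simp: disjnt_def)
    qed
  qed
  moreover have "(\<exists>\<rho>. dom \<rho> \<subseteq> J \<and> card (dom \<rho>) \<le> s \<and> cell x = subcube J \<rho>) \<and> f constant_on cell x"
    for x
  proof (intro conjI exI)
    let ?\<rho> = "\<lambda>i. if i \<in> V x then Some (x i) else None"
    have dom: "dom ?\<rho> = V x" by (auto split: if_splits)
    show "dom ?\<rho> \<subseteq> J" unfolding dom using certfD(1)[OF V] assms(3) by blast
    show "card (dom ?\<rho>) \<le> s" unfolding dom using certfD(2)[OF V, of x] by simp
    show "cell x = subcube J ?\<rho>" unfolding subcube_def dom cell_def agree_def by auto
    show "f constant_on cell x"
      unfolding constant_on_def cell_def using certfD(3)[OF V] by blast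
  qed
  ultimately show "subcube_partition J f s (cell ` cube J)"
    unfolding subcube_partition_def by blast
qed

lemma subcube_partition_complexity_le:
  assumes "certf True I s s f V" "finite J" "I \<subseteq> J"
  shows "subcube_partition_complexity J f \<le> s"
  unfolding subcube_partition_complexity_def
  using subcube_partition_certf[OF assms] by (rule Least_le)

text \<open>In an optimal partition, the subcube that contains the hard input \<open>z\<close>,
  restricted to \<open>J\<close>, fixes a set of variables that certifies \<open>z\<close>. The
  unambiguous certificates ensure that a partition exists at all.\<close>

lemma subcube_partition_complexity_ge:
  assumes V: "certf True I s s f V" and J: "finite J" "I \<subseteq> J" and "min_cert_ge n f"
  shows "n \<le> subcube_partition_complexity J f"
proof -
  define k where "k = subcube_partition_complexity J f"
  obtain P where P: "subcube_partition J f k P"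
    unfolding k_def subcube_partition_complexity_def
    using LeastI_ex[of "\<lambda>k. \<exists>P. subcube_partition J f k P"] subcube_partition_certf[OF V J] by blast
  obtain z where z: "\<And>W. finite W \<Longrightarrow> certifies f W z \<Longrightarrow> n \<le> card W"
    using assms(4) unfolding min_cert_ge_def by blast
  have restr: "f (restrict x J) = f x" for x
    using J(2) by (intro certf_depends[OF V]) (auto simp: agree_def)
  have "restrict z J \<in> \<Union> P"
    using P partition_onD1 unfolding subcube_partition_def by (metis restrict_in_cube)
  then obtain C where C: "C \<in> P" "restrict z J \<in> C" by blast
  then obtain \<rho> where \<rho>: "dom \<rho> \<subseteq> J" "card (dom \<rho>) \<le> k" "C = subcube J \<rho>"
    and const: "f constant_on C"
    using P unfolding subcube_partition_def by blast
  have "certifies f (dom \<rho>) z"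
    unfolding certifies_def
  proof (intro allI impI)
    fix y assume "agree (dom \<rho>) z y"
    then have "restrict y J \<in> C"
      using C(2) \<rho>(1) unfolding \<rho>(3) subcube_def agree_def by auto
    then have "f (restrict y J) = f (restrict z J)"
      using const C(2) unfolding constant_on_def by metis
    then show "f y = f z" by (simp only: restr)
  qed
  moreover have "finite (dom \<rho>)" using \<rho>(1) J(1) by (rule finite_subset)
  ultimately have "n \<le> card (dom \<rho>)" using z by blast
  then show ?thesis using \<rho>(2) unfolding k_def by (rule order.trans)
qed

section \<open>Choice of parameters and the exponent\<close>

lemma near_quadratic_gap:
  "\<exists>(N :: nat) f. k \<le> subcube_partition_complexity {..<N} f \<and>
    real (det_query_complexity {..<N} f)
      \<ge> real (subcube_partition_complexity {..<N} f) powr (2 - 2 / real (Suc k))"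
proof -
  obtain a where a: "\<And>L. L \<ge> 2 \<Longrightarrow> \<exists>I f. stage k a L I f" using ex_stage by blast
  \<comment> \<open>\<open>L\<close> is chosen so large that the square of the polylogarithmic
    factor \<open>L ^ a\<close> is below the fan-in \<open>2 ^ L\<close>;
    \<open>L \<ge> 2 + k\<close> will give \<open>k < 2 ^ L \<le> S\<close>.\<close>
  have "(\<lambda>L. real L ^ (2 * a) / 2 ^ L) \<longlonglongrightarrow> 0"
    by real_asymp
  then have "\<forall>\<^sub>F L in sequentially. real L ^ (2 * a) / 2 ^ L < 1"
    by (rule order_tendstoD) simp
  then have "\<forall>\<^sub>F L in sequentially. real L ^ (2 * a) / 2 ^ L < 1 \<and> L \<ge> 2 + k"
    using eventually_ge_at_top eventually_conj by blast
  then obtain L where L: "real L ^ (2 * a) / 2 ^ L < 1" "L \<ge> 2 + k"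
    using eventually_happens' sequentially_bot by blast
  obtain I f where "stage k a L I f" using a[of L] L(2) by auto
  then obtain U where f: "finite I" "hard f ((2 ^ L) ^ (2 * k + 1)) Map.empty"
    "certf True I (L ^ a * (2 ^ L) ^ (k + 1)) (L ^ a * (2 ^ L) ^ (k + 1)) f U"
    "min_cert_ge (2 ^ L) f"
    unfolding stage_def by blast
  obtain N where N: "I \<subseteq> {..<N}" using finite_nat_iff_bounded f(1) by blast
  define S where "S = subcube_partition_complexity {..<N} f"
  have D: "(2 ^ L) ^ (2 * k + 1) \<le> det_query_complexity {..<N} f"
    using N by (intro det_query_complexity_ge[OF _ _ f(2)] certf_depends[OF f(3)]) (auto simp: agree_def)
  have S: "S \<le> L ^ a * (2 ^ L) ^ (k + 1)"
    unfolding S_def using N by (intro subcube_partition_complexity_le[OF f(3)]) auto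
  have "2 ^ L \<le> S"
    unfolding S_def using N by (intro subcube_partition_complexity_ge[OF f(3) _ _ f(4)]) auto
  then have "k \<le> S" using L(2) less_exp[of L] by linarith
  define n where "n = (2 :: real) ^ L"
  \<comment> \<open>As \<open>\<delta> = 2 * k / (k + 1)\<close>, raising \<open>n ^ (k + 1)\<close>
    to the power \<open>\<delta>\<close> gives \<open>n ^ (2 * k)\<close>. This is a factor
    \<open>n\<close> short of the deterministic bound \<open>n ^ (2 * k + 1)\<close>, and that
    factor absorbs \<open>L ^ (2 * a)\<close>.\<close>
  define \<delta> where "\<delta> = 2 - 2 / real (Suc k)"
  have \<delta>: "0 \<le> \<delta>" "\<delta> \<le> 2" "real (Suc k) * \<delta> = real (2 * k)"
    by (auto simp: \<delta>_def field_simps)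
  have n: "n > 0" by (simp add: n_def)
  have L1: "real L \<ge> 1" using L(2) by simp
  have "real S \<le> real (L ^ a * (2 ^ L) ^ (k + 1))" using S by (rule of_nat_mono)
  also have "\<dots> = real L ^ a * n ^ (k + 1)" by (simp add: n_def)
  finally have "real S powr \<delta> \<le> (real L ^ a * n ^ (k + 1)) powr \<delta>"
    using \<delta>(1) by (intro powr_mono2) auto
  also have "\<dots> = (real L ^ a) powr \<delta> * (n ^ Suc k) powr \<delta>"
    using n by (simp add: powr_mult)
  also have "(n ^ Suc k) powr \<delta> = n powr (real (Suc k) * \<delta>)"
    using n by (simp only: powr_realpow[symmetric] powr_powr)
  also have "\<dots> = n ^ (2 * k)" using n by (simp only: \<delta>(3) powr_realpow)
  also have "(real L ^ a) powr \<delta> \<le> (real L ^ a) powr 2"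
    using L1 \<delta>(2) by (intro powr_mono) simp_all
  also have "(real L ^ a) powr 2 = real L ^ (2 * a)"
    using L1 by (simp add: power_mult[symmetric] mult.commute)
  also have "\<dots> \<le> n" using L(1) by (simp add: n_def)
  also have "n * n ^ (2 * k) = real ((2 ^ L) ^ (2 * k + 1))" by (simp add: n_def)
  also have "\<dots> \<le> real (det_query_complexity {..<N} f)" using D by (rule of_nat_mono)
  finally have "real S powr \<delta> \<le> real (det_query_complexity {..<N} f)"
    using n by simp
  then show ?thesis using \<open>k \<le> S\<close> unfolding S_def \<delta>_def by blast
qed

theorem theorem1:
  shows "\<exists>(N :: nat \<Rightarrow> nat) (f :: nat \<Rightarrow> (nat \<Rightarrow> bool) \<Rightarrow> bool) (\<epsilon> :: nat \<Rightarrow> real).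
    filterlim (\<lambda>k. subcube_partition_complexity {..<N k} (f k)) at_top sequentially \<and>
    \<epsilon> \<longlonglongrightarrow> 0 \<and>
    (\<forall>\<^sub>F k in sequentially.
       real (det_query_complexity {..<N k} (f k))
         \<ge> real (subcube_partition_complexity {..<N k} (f k)) powr (2 - \<epsilon> k))"
proof -
  obtain N :: "nat \<Rightarrow> nat" and f where
    sc: "\<And>k. k \<le> subcube_partition_complexity {..<N k} (f k)" and
    gap: "\<And>k. real (det_query_complexity {..<N k} (f k))
      \<ge> real (subcube_partition_complexity {..<N k} (f k)) powr (2 - 2 / real (Suc k))"
    using near_quadratic_gap by metis
  have "filterlim (\<lambda>k. subcube_partition_complexity {..<N k} (f k)) at_top sequentially"
    using filterlim_ident sc by (rule filterlim_at_top_mono[OF _ always_eventually[OF allI]])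
  moreover have "(\<lambda>k. 2 / real (Suc k)) \<longlonglongrightarrow> 0"
    using tendsto_mult_right_zero[OF LIMSEQ_inverse_real_of_nat, of 2] by (simp add: divide_inverse)
  ultimately show ?thesis
    using gap by (intro exI[of _ N] exI[of _ f] exI[of _ "\<lambda>k. 2 / real (Suc k)"]) auto
qed

end
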